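(* For every integer $d\geq 8$ there exists a smooth and strictly convex body $K\subset\mathbb{R}^d$ with $H_{\mathrm{sep}}(K)\geq 2d+2$. Moreover, for $d=9,10,11,12,14$ there exists a smooth and strictly convex body $K\subset\mathbb{R}^d$ with $H_{\mathrm{sep}}(K)\geq 29, 39, 50, 65, 91$, respectively.
   Context: A convex body in $\mathbb{R}^d$ is a compact convex set with nonempty interior. It is smooth if it has a unique supporting hyperplane at each boundary point, and strictly convex if its boundary contains no nondegenerate line segment. A translative packing of a convex body $K$ is a finite collection $\{x_1+K,\dots,x_n+K\}$ of (distinct) translates of $K$ such that no two of them have interior points in common. Two translates in the packing touch if they have a common boundary point. The packing is totally separable if any two touching translates in it have a separating hyperplane that does not intersect the interior of any translate in the packing. The contact graph of the packing is the graph whose vertices are the translates, two being joined by an edge iff they touch. The separable Hadwiger number $H_{\mathrm{sep}}(K)$ is the maximum degree of a vertex in the contact graph, the maximum being taken over all totally separable packings of translates of $K$. *)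

theory Defs
  imports "HOL-Analysis.Analysis" "HOL-Library.Extended_Nat"
begin

definition convex_body :: "'a::euclidean_space set \<Rightarrow> bool" where
  "convex_body K \<longleftrightarrow> compact K \<and> convex K \<and> interior K \<noteq> {}"

definition supporting_hyperplane_at :: "'a::euclidean_space set \<Rightarrow> 'a \<Rightarrow> 'a set \<Rightarrow> bool" where
  "supporting_hyperplane_at K x H \<longleftrightarrow>
     (\<exists>a b. a \<noteq> 0 \<and> H = {y. a \<bullet> y = b} \<and> x \<in> H \<and> K \<subseteq> {y. a \<bullet> y \<le> b})"

definition smooth_body :: "'a::euclidean_space set \<Rightarrow> bool" where
  "smooth_body K \<longleftrightarrow> convex_body K \<and> (\<forall>x\<in>frontier K. \<exists>!H. supporting_hyperplane_at K x H)"

definition strictly_convex_body :: "'a::euclidean_space set \<Rightarrow> bool" where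
  "strictly_convex_body K \<longleftrightarrow>
     convex_body K \<and> \<not> (\<exists>x y. x \<noteq> y \<and> closed_segment x y \<subseteq> frontier K)"

text \<open>A packing is the set of the translates themselves (not of the translation vectors),
  so its members are automatically distinct.\<close>

definition translative_packing :: "'a::euclidean_space set \<Rightarrow> 'a set set \<Rightarrow> bool" where
  "translative_packing K P \<longleftrightarrow>
     finite P \<and> (\<forall>A\<in>P. \<exists>x. A = (+) x ` K) \<and>
     (\<forall>A\<in>P. \<forall>B\<in>P. A \<noteq> B \<longrightarrow> interior A \<inter> interior B = {})"

definition touch :: "'a::euclidean_space set \<Rightarrow> 'a set \<Rightarrow> bool" where
  "touch A B \<longleftrightarrow> A \<noteq> B \<and> frontier A \<inter> frontier B \<noteq> {}"

definition separating_hyperplane :: "'a::euclidean_space set \<Rightarrow> 'a set \<Rightarrow> 'a set \<Rightarrow> bool" where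
  "separating_hyperplane A B H \<longleftrightarrow>
     (\<exists>a b. a \<noteq> 0 \<and> H = {y. a \<bullet> y = b} \<and> A \<subseteq> {y. a \<bullet> y \<le> b} \<and> B \<subseteq> {y. a \<bullet> y \<ge> b})"

definition totally_separable_packing :: "'a::euclidean_space set \<Rightarrow> 'a set set \<Rightarrow> bool" where
  "totally_separable_packing K P \<longleftrightarrow>
     translative_packing K P \<and>
     (\<forall>A\<in>P. \<forall>B\<in>P. touch A B \<longrightarrow>
        (\<exists>H. separating_hyperplane A B H \<and> (\<forall>C\<in>P. H \<inter> interior C = {})))"

definition contact_edges :: "'a::euclidean_space set set \<Rightarrow> 'a set set set" where
  "contact_edges P = {{A, B} | A B. A \<in> P \<and> B \<in> P \<and> touch A B}"

definition contact_degree :: "'a::euclidean_space set set \<Rightarrow> 'a set \<Rightarrow> nat" where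
  "contact_degree P A = card {e \<in> contact_edges P. A \<in> e}"

text \<open>The maximum is taken as a supremum in \<^typ>\<open>enat\<close>, which is the maximum whenever the degrees are
  bounded; on \<^typ>\<open>nat\<close>, \<^const>\<open>Max\<close> would be unspecified for an infinite set.\<close>

definition H_sep :: "'a::euclidean_space set \<Rightarrow> enat" where
  "H_sep K = Sup {enat (contact_degree P A) | P A. totally_separable_packing K P \<and> A \<in> P}"

end

theory Submission
  imports Defs
begin

text \<open>
  Let \<open>K\<close> be a strictly convex body with \<open>K = - K\<close>, let \<open>v\<^sub>1, \<dots>, v\<^sub>N\<close> be boundary points and let
  \<open>n\<^sub>j \<bullet> x \<le> 1\<close> be a supporting half-space of \<open>K\<close> at \<open>v\<^sub>j\<close>. The translates \<open>2 v\<^sub>j + K\<close> touch \<open>K\<close> at \<open>v\<^sub>j\<close>,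
  and \<open>n\<^sub>j \<bullet> x = 1\<close> separates the two. On another translate \<open>2 v\<^sub>i + K\<close> the functional \<open>n\<^sub>j\<close> takes values
  within 1 of \<open>2 (n\<^sub>j \<bullet> v\<^sub>i)\<close>, so the hyperplane misses its interior as soon as \<open>n\<^sub>j \<bullet> v\<^sub>i \<le> 0\<close>. Hence \<open>N\<close>
  such pairs with \<open>n\<^sub>j \<bullet> v\<^sub>i \<le> 0\<close> for all \<open>i \<noteq> j\<close> give \<open>H_sep K \<ge> N\<close> (\<open>card_le_H_sep\<close>).

  If functionals \<open>g\<^sub>j\<close> and points \<open>v\<^sub>j\<close> are prescribed with \<open>g\<^sub>j \<bullet> v\<^sub>j = 1\<close> and \<open>-1 < g\<^sub>j \<bullet> v\<^sub>i < 0\<close> for \<open>i \<noteq> j\<close>,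
  a body of the required kind is \<open>{x. \<Sum>\<^sub>k (g\<^sub>k \<bullet> x) ^ p \<le> 1}\<close> for a large even \<open>p\<close>. It is smooth and strictly
  convex, provided that the \<open>g\<^sub>k\<close> span, which small multiples of the
  coordinate functionals ensure when added. Its outer normal at (a multiple of) \<open>v\<^sub>j\<close> is
  \<open>\<Sum>\<^sub>k (g\<^sub>k \<bullet> v\<^sub>j) ^ (p - 1) *\<^sub>R g\<^sub>k\<close>, which tends to
  \<open>g\<^sub>j\<close> as \<open>p\<close> grows, so the strict inequalities \<open>g\<^sub>j \<bullet> v\<^sub>i < 0\<close> survive for some finite \<open>p\<close>
  (\<open>obtuse_family_H_sep\<close>).

  It remains to find many such pairs in few dimensions. If the matrix \<open>(g\<^sub>j \<bullet> v\<^sub>i)\<close> is symmetric and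
  positive semidefinite, there are at most \<open>2 d\<close> pairs, as for obtuse systems of vectors; the gain comes
  from an indefinite form. For \<open>x\<close> in \<open>\<real>\<^bsup>d-1\<^esup>\<close> take the point \<open>(x, 1)\<close> and the functional \<open>(x, -T)\<close>, scaled to
  have value 1 at that point. The condition on two such points becomes
  \<open>2 T - \<bar>x\<bar>\<^sup>2 < x \<bullet> y < T\<close>, with the same for \<open>y\<close> in place of \<open>x\<close>: on the unit sphere, all inner products
  lie between \<open>2 T - 1\<close> and \<open>T\<close>. Already for \<open>d = 8\<close> there are
  more than \<open>2 d\<close> such points: explicit integer point sets have 18, 29, 39, 50, 66 and 91 elements for
  \<open>d = 8, 9, 10, 11, 12, 14\<close>. Finally, every additional dimension contributes the two unit vectors
  \<open>\<plusminus> e\<close> of a new coordinate axis, which turns the 18 points for \<open>d = 8\<close> into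
  \<open>18 + 2 (d - 8) = 2 d + 2\<close> in all dimensions \<open>d \<ge> 8\<close>
  (\<open>separated_integer_points_H_sep\<close>).
\<close>

section \<open>A criterion for many separable neighbours\<close>

lemma halfspace_interior_less:
  fixes n :: "'a::euclidean_space"
  assumes "K \<subseteq> {y. n \<bullet> y \<le> b}" "n \<noteq> 0" "z \<in> interior K"
  shows "n \<bullet> z < b"
proof -
  have "z \<in> interior {y. n \<bullet> y \<le> b}"
    using assms interior_mono by blast
  then show ?thesis
    using assms(2) by simp
qed

text \<open>A second point of contact would put the whole segment between the two into the boundary.\<close>

lemma strictly_convex_support_point_unique:
  fixes n :: "'a::euclidean_space"
  assumes K: "strictly_convex_body K" and n: "K \<subseteq> {y. n \<bullet> y \<le> b}" "n \<noteq> 0"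
    and x: "x \<in> K" "n \<bullet> x = b" and y: "y \<in> K" "n \<bullet> y = b"
  shows "x = y"
proof (rule ccontr)
  assume "x \<noteq> y"
  have "closed_segment x y \<subseteq> frontier K"
  proof
    fix z assume z: "z \<in> closed_segment x y"
    have "convex K"
      using K by (simp add: strictly_convex_body_def convex_body_def)
    then have "z \<in> K"
      using z x(1) y(1) closed_segment_subset by blast
    moreover have "n \<bullet> z = b"
    proof -
      obtain u where "z = (1 - u) *\<^sub>R x + u *\<^sub>R y"
        using z by (auto simp: in_segment)
      then show ?thesis
        using x(2) y(2) by (simp add: inner_add_right left_diff_distrib)
    qed
    ultimately show "z \<in> frontier K"
      using halfspace_interior_less[OF n, of z] closure_subset by (fastforce simp: frontier_def)
  qed
  then show False
    using K \<open>x \<noteq> y\<close> by (auto simp: strictly_convex_body_def)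
qed

text \<open>The packing consists of \<open>K\<close> and all \<open>2 v\<^sub>j + K\<close>. Since \<open>n\<^sub>j\<close> lies between -1 and 1 on \<open>K\<close>, it is at most 1 on
  every member except \<open>2 v\<^sub>j + K\<close>, where it is at least 1; so the hyperplane \<open>n\<^sub>j \<bullet> x = 1\<close> separates that translate
  from the whole rest of the packing. No hyperplanes between the neighbours of \<open>K\<close> have to be found, because by
  strict convexity these do not touch one another.\<close>

theorem card_le_H_sep:
  fixes v n :: "'j \<Rightarrow> 'a::euclidean_space"
  assumes K: "strictly_convex_body K" and sym: "\<And>x. x \<in> K \<Longrightarrow> - x \<in> K"
    and fin: "finite J"
    and v: "\<And>j. j \<in> J \<Longrightarrow> v j \<in> K"
    and n: "\<And>j x. j \<in> J \<Longrightarrow> x \<in> K \<Longrightarrow> n j \<bullet> x \<le> 1"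
    and nv: "\<And>j. j \<in> J \<Longrightarrow> n j \<bullet> v j = 1"
    and obtuse: "\<And>i j. i \<in> J \<Longrightarrow> j \<in> J \<Longrightarrow> i \<noteq> j \<Longrightarrow> n j \<bullet> v i \<le> 0"
  shows "enat (card J) \<le> H_sep K"
proof -
  define A where "A j = (+) (2 *\<^sub>R v j) ` K" for j
  define P where "P = insert K (A ` J)"
  have n0: "n j \<noteq> 0" if "j \<in> J" for j
    using nv[OF that] by auto
  have sub: "K \<subseteq> {y. n j \<bullet> y \<le> 1}" "K \<subseteq> {y. (- n j) \<bullet> y \<le> 1}" if "j \<in> J" for j
    using n[OF that] sym by (auto, force)
  have intK: "n j \<bullet> z < 1" "n j \<bullet> z > -1" if "j \<in> J" "z \<in> interior K" for j z
    using halfspace_interior_less[OF sub(1)[OF that(1)] n0[OF that(1)] that(2)]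
      halfspace_interior_less[OF sub(2)[OF that(1)] _ that(2)] n0[OF that(1)] by auto
  have intA: "interior (A j) = (+) (2 *\<^sub>R v j) ` interior K" for j
    by (simp add: A_def interior_translation)
  have frA: "frontier (A j) = (+) (2 *\<^sub>R v j) ` frontier K" for j
    by (simp add: A_def frontier_translation)
  have own: "n j \<bullet> z > 1" if "j \<in> J" "z \<in> interior (A j)" for j z
    using that intK(2)[OF that(1)] nv[OF that(1)] by (fastforce simp: intA inner_add_right)
  have other: "n j \<bullet> z < 1" if "j \<in> J" "i \<in> J" "i \<noteq> j" "z \<in> interior (A i)" for i j z
    using that intK(1)[OF that(1)] obtuse[OF that(2,1,3)] by (fastforce simp: intA inner_add_right)
  have ne: "interior K \<noteq> {}" and cl: "closed K"
    using K by (auto simp: strictly_convex_body_def convex_body_def compact_imp_closed)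
  have neA: "interior (A j) \<noteq> {}" for j
    using ne by (simp add: intA)
  have disjK: "interior (A j) \<inter> interior K = {}" if "j \<in> J" for j
    using own[OF that] intK(1)[OF that] by force
  have disjA: "interior (A i) \<inter> interior (A j) = {}" if "i \<in> J" "j \<in> J" "i \<noteq> j" for i j
    using own[OF that(2)] other[OF that(2,1,3)] by force
  have AK: "A j \<noteq> K" if "j \<in> J" for j
    using disjK[OF that] ne by auto
  have injA: "inj_on A J"
    using disjA neA by (metis inf.idem inj_onI)
  have frsub: "frontier K \<subseteq> K"
    using cl by (simp add: frontier_subset_closed)
  have no_touch: "\<not> touch (A i) (A j)" if ij: "i \<in> J" "j \<in> J" "i \<noteq> j" for i j
  proof
    assume "touch (A i) (A j)"
    then obtain z where z: "z \<in> (+) (2 *\<^sub>R v i) ` frontier K" "z \<in> (+) (2 *\<^sub>R v j) ` frontier K"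
      unfolding touch_def frA by blast
    then obtain x y where "x \<in> frontier K" "y \<in> frontier K"
      and eq: "2 *\<^sub>R v i + x = 2 *\<^sub>R v j + y"
      by (elim imageE) simp
    then have x: "x \<in> K" and y: "y \<in> K"
      using frsub by auto
    \<comment> \<open>At a common point \<open>z\<close> the functional \<open>n j\<close> is at most 1, seen from \<open>A i\<close>, and at least 1, seen from \<open>A j\<close>.
        So \<open>z\<close> lies on the hyperplane of \<open>n j\<close>, which meets \<open>A j\<close> only in \<open>v j\<close>. By symmetry \<open>z = v i\<close>.\<close>
    have *: "2 * (n k \<bullet> v i) + n k \<bullet> x = 2 * (n k \<bullet> v j) + n k \<bullet> y" for k
      using arg_cong[OF eq, of "\<lambda>z. n k \<bullet> z"] by (simp add: inner_add_right)
    have "n j \<bullet> (- y) = 1"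
      using *[of j] nv[OF ij(2)] obtuse[OF ij] n[OF ij(2) x] n[OF ij(2) sym[OF y]] by simp
    then have y': "- y = v j"
      using strictly_convex_support_point_unique[OF K sub(1) n0] sym[OF y] v nv ij by blast
    have "n i \<bullet> (- x) = 1"
      using *[of i] nv[OF ij(1)] obtuse[OF ij(2,1)] ij n[OF ij(1) y] n[OF ij(1) sym[OF x]] by simp
    then have "- x = v i"
      using strictly_convex_support_point_unique[OF K sub(1) n0] sym[OF x] v nv ij by blast
    then have "x = - v i" "y = - v j"
      using y' by (metis minus_minus)+
    then have "v i = v j"
      using eq by (simp add: scaleR_2)
    then show False
      using obtuse[OF ij] nv[OF ij(2)] by simp
  qed
  have pack: "translative_packing K P"
    unfolding translative_packing_def
  proof (intro conjI ballI impI)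
    show "finite P"
      using fin by (simp add: P_def)
    show "\<exists>x. B = (+) x ` K" if "B \<in> P" for B
    proof (cases "B = K")
      case True
      then show ?thesis by (intro exI[of _ 0]) auto
    next
      case False
      then show ?thesis using that by (auto simp: P_def A_def)
    qed
    show "interior B \<inter> interior C = {}" if "B \<in> P" "C \<in> P" "B \<noteq> C" for B C
      using that disjK disjA unfolding P_def by blast
  qed
  have hyper: "separating_hyperplane K (A j) {y. n j \<bullet> y = 1}"
    "separating_hyperplane (A j) K {y. n j \<bullet> y = 1}"
    "\<forall>C\<in>P. {y. n j \<bullet> y = 1} \<inter> interior C = {}" if j: "j \<in> J" for j
  proof -
    have low: "n j \<bullet> y \<ge> 1" if "y \<in> A j" for y
      using that n[OF j sym] nv[OF j] by (force simp: A_def inner_add_right)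
    show "separating_hyperplane K (A j) {y. n j \<bullet> y = 1}"
      unfolding separating_hyperplane_def using n0[OF j] sub(1)[OF j] low
      by (intro exI[of _ "n j"] exI[of _ 1]) auto
    show "separating_hyperplane (A j) K {y. n j \<bullet> y = 1}"
      unfolding separating_hyperplane_def using n0[OF j] sub(1)[OF j] low
      by (intro exI[of _ "- n j"] exI[of _ "-1"]) auto
    show "\<forall>C\<in>P. {y. n j \<bullet> y = 1} \<inter> interior C = {}"
      using own[OF j] other[OF j] intK(1)[OF j] by (force simp: P_def)
  qed
  have sep: "totally_separable_packing K P"
    unfolding totally_separable_packing_def
  proof (intro conjI ballI impI pack)
    fix B C assume "B \<in> P" "C \<in> P" and t: "touch B C"
    then consider "B = K" "C = K" | j where "j \<in> J" "B = K" "C = A j"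
      | j where "j \<in> J" "B = A j" "C = K" | i j where "i \<in> J" "j \<in> J" "B = A i" "C = A j"
      unfolding P_def by blast
    then show "\<exists>H. separating_hyperplane B C H \<and> (\<forall>C\<in>P. H \<inter> interior C = {})"
    proof cases
      case 1
      then show ?thesis using t by (simp add: touch_def)
    next
      case 2
      then show ?thesis using hyper by blast
    next
      case 3
      then show ?thesis using hyper by blast
    next
      case 4
      then show ?thesis using t no_touch[of i j] by (auto simp: touch_def)
    qed
  qed
  have "touch K (A j)" if j: "j \<in> J" for j
  proof -
    have fr: "x \<in> frontier K" if "x \<in> K" "\<bar>n j \<bullet> x\<bar> = 1" for x
      using that intK[OF j, of x] closure_subset[of K] by (auto simp: frontier_def)
    have "v j \<in> frontier K" "- v j \<in> frontier K"
      using fr v[OF j] sym nv[OF j] by auto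
    moreover have "v j = 2 *\<^sub>R v j + (- v j)"
      by (simp add: scaleR_2)
    ultimately have "v j \<in> frontier K \<inter> frontier (A j)"
      unfolding frA by blast
    then show ?thesis
      using AK[OF j] by (auto simp: touch_def)
  qed
  then have edges: "(\<lambda>j. {K, A j}) ` J \<subseteq> {e \<in> contact_edges P. K \<in> e}"
    by (auto simp: contact_edges_def P_def)
  have fin_edges: "finite {e \<in> contact_edges P. K \<in> e}"
  proof (rule finite_subset)
    show "{e \<in> contact_edges P. K \<in> e} \<subseteq> Pow P"
      by (auto simp: contact_edges_def)
    show "finite (Pow P)"
      using fin by (simp add: P_def)
  qed
  have "inj_on (\<lambda>j. {K, A j}) J"
    using injA by (auto simp: inj_on_def doubleton_eq_iff)
  from card_image[OF this] card_mono[OF fin_edges edges]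
  have "card J \<le> contact_degree P K"
    by (simp add: contact_degree_def)
  then have "enat (card J) \<le> enat (contact_degree P K)"
    by simp
  also have "\<dots> \<le> H_sep K"
    unfolding H_sep_def using sep by (intro Sup_upper) (auto simp: P_def)
  finally show ?thesis .
qed

section \<open>Unit balls of sums of even powers of linear forms\<close>

text \<open>The graph of \<open>t ^ (2 * r)\<close> lies strictly above its tangent at \<open>a\<close>, written in a form that stays valid when
  summed over several linear forms.\<close>

lemma even_power_tangent_less:
  fixes a b :: real
  assumes "r > 0" "a \<noteq> b"
  shows "2 * real r * a ^ (2 * r - 1) * b < (2 * real r - 1) * a ^ (2 * r) + b ^ (2 * r)"
proof (cases "a = 0")
  case True
  moreover have "b ^ (2 * r) > 0"
    using assms True by (simp add: power_mult)
  ultimately show ?thesis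
    using assms by (simp add: power_0_left)
next
  case False
  define t where "t = b / a - 1"
  have t: "t \<noteq> 0" and b: "b = a * (1 + t)"
    using False assms by (auto simp: t_def field_simps)
  have pow: "a ^ (2 * r) = a * a ^ (2 * r - 1)"
    using assms(1) by (simp flip: power_Suc)
  have pos: "a ^ (2 * r) > 0"
    using False by (simp add: power_mult)
  \<comment> \<open>Squaring first gains the quadratic excess \<open>r * t\<^sup>2\<close> over Bernoulli's inequality.\<close>
  have "1 + real r * (2 * t + t\<^sup>2) \<le> (1 + (2 * t + t\<^sup>2)) ^ r"
  proof (rule Bernoulli_inequality)
    have "0 \<le> (1 + t)\<^sup>2"
      by simp
    then show "- 1 \<le> 2 * t + t\<^sup>2"
      by (simp add: power2_sum)
  qed
  also have "1 + (2 * t + t\<^sup>2) = (1 + t)\<^sup>2"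
    by (simp add: power2_sum)
  finally have "1 + real r * (2 * t + t\<^sup>2) \<le> (1 + t) ^ (2 * r)"
    by (simp add: power_mult)
  moreover have "real r * t\<^sup>2 > 0"
    using assms(1) t by simp
  ultimately have "1 + 2 * real r * t < (1 + t) ^ (2 * r)"
    by (simp add: algebra_simps)
  then have "a ^ (2 * r) * (1 + 2 * real r * t) < a ^ (2 * r) * (1 + t) ^ (2 * r)"
    using pos by simp
  also have "\<dots> = b ^ (2 * r)"
    by (simp add: b power_mult_distrib)
  finally show ?thesis
    unfolding pow by (simp add: b algebra_simps)
qed

text \<open>The function \<open>power_sum\<close> is homogeneous of degree \<open>2 * r\<close> and \<open>normal\<close> is its gradient divided by \<open>2 * r\<close>, so that
  Euler's identity reads \<open>normal x \<bullet> x = power_sum x\<close> and \<open>normal x \<bullet> y \<le> 1\<close> is the supporting half-space at a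
  boundary point \<open>x\<close>.\<close>

locale power_body =
  fixes g :: "'k \<Rightarrow> 'a::euclidean_space" and I :: "'k set" and r :: nat
  assumes finite_I: "finite I" and r_pos: "r > 0"
    and spanning: "\<And>x. (\<And>k. k \<in> I \<Longrightarrow> g k \<bullet> x = 0) \<Longrightarrow> x = 0"
begin

definition power_sum :: "'a \<Rightarrow> real"
  where "power_sum x = (\<Sum>k\<in>I. (g k \<bullet> x) ^ (2 * r))"

definition normal :: "'a \<Rightarrow> 'a"
  where "normal x = (\<Sum>k\<in>I. (g k \<bullet> x) ^ (2 * r - 1) *\<^sub>R g k)"

definition body :: "'a set"
  where "body = {x. power_sum x \<le> 1}"

lemma normal_inner: "normal x \<bullet> y = (\<Sum>k\<in>I. (g k \<bullet> x) ^ (2 * r - 1) * (g k \<bullet> y))"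
  by (simp add: normal_def inner_sum_left)

lemma normal_inner_self: "normal x \<bullet> x = power_sum x"
proof -
  have "(2 * r - 1) + 1 = 2 * r"
    using r_pos by simp
  then have "(g k \<bullet> x) ^ (2 * r - 1) * (g k \<bullet> x) = (g k \<bullet> x) ^ (2 * r)" for k
    by (metis power_add power_one_right)
  then show ?thesis
    by (simp add: normal_inner power_sum_def)
qed

lemma power_sum_scaleR: "power_sum (c *\<^sub>R x) = c ^ (2 * r) * power_sum x"
  by (simp add: power_sum_def power_mult_distrib sum_distrib_left)

lemma normal_scaleR: "normal (c *\<^sub>R x) = c ^ (2 * r - 1) *\<^sub>R normal x"
  by (simp add: normal_def power_mult_distrib scaleR_sum_right)

lemma power_sum_pos: "x \<noteq> 0 \<Longrightarrow> power_sum x > 0"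
proof -
  assume "x \<noteq> 0"
  then obtain k where "k \<in> I" "g k \<bullet> x \<noteq> 0"
    using spanning by blast
  then show ?thesis
    unfolding power_sum_def using finite_I by (intro sum_pos2[of _ k]) (auto simp: power_mult)
qed

lemma continuous_power_sum: "continuous_on S power_sum"
  unfolding power_sum_def by (intro continuous_intros)

text \<open>Distinct points differ in at least one of the spanning forms, which makes the summed tangent inequality strict.
  Convexity, strict convexity and the supporting hyperplanes of the body are all read off from it.\<close>

lemma power_sum_tangent_less:
  assumes "x \<noteq> y"
  shows "2 * real r * (normal x \<bullet> y) < (2 * real r - 1) * power_sum x + power_sum y"
proof -
  have "\<exists>k\<in>I. g k \<bullet> x \<noteq> g k \<bullet> y"
    using spanning[of "x - y"] assms by (auto simp: inner_diff_right)
  moreover have *: "g k \<bullet> x \<noteq> g k \<bullet> y \<Longrightarrow> 2 * real r * ((g k \<bullet> x) ^ (2 * r - 1) * (g k \<bullet> y))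
      < (2 * real r - 1) * (g k \<bullet> x) ^ (2 * r) + (g k \<bullet> y) ^ (2 * r)" for k
    using even_power_tangent_less[OF r_pos, of "g k \<bullet> x" "g k \<bullet> y"] by (simp add: mult.assoc)
  moreover have "2 * real r * ((g k \<bullet> x) ^ (2 * r - 1) * (g k \<bullet> y))
      \<le> (2 * real r - 1) * (g k \<bullet> x) ^ (2 * r) + (g k \<bullet> y) ^ (2 * r)" for k
  proof (cases "g k \<bullet> x = g k \<bullet> y")
    case True
    have "(g k \<bullet> y) ^ (2 * r - 1) * (g k \<bullet> y) = (g k \<bullet> y) ^ (2 * r)"
      using r_pos by (metis One_nat_def Suc_pred mult_pos_pos pos2 power_Suc2)
    then show ?thesis
      unfolding True by (simp add: algebra_simps)
  next
    case False
    then show ?thesis using * by fastforce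
  qed
  ultimately have "(\<Sum>k\<in>I. 2 * real r * ((g k \<bullet> x) ^ (2 * r - 1) * (g k \<bullet> y)))
      < (\<Sum>k\<in>I. (2 * real r - 1) * (g k \<bullet> x) ^ (2 * r) + (g k \<bullet> y) ^ (2 * r))"
    by (intro sum_strict_mono_ex1 finite_I) auto
  then show ?thesis
    by (simp add: normal_inner power_sum_def sum.distrib sum_distrib_left)
qed

lemma normal_le_1: "power_sum x = 1 \<Longrightarrow> y \<in> body \<Longrightarrow> normal x \<bullet> y \<le> 1"
proof (cases "x = y")
  case True
  then show "power_sum x = 1 \<Longrightarrow> normal x \<bullet> y \<le> 1"
    by (simp add: normal_inner_self)
next
  case False
  assume "power_sum x = 1" "y \<in> body"
  then have "2 * real r * (normal x \<bullet> y) < 2 * real r * 1"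
    using power_sum_tangent_less[OF False] by (simp add: body_def)
  then show ?thesis
    using r_pos by simp
qed

lemma normal_eq_1: "power_sum x = 1 \<Longrightarrow> y \<in> body \<Longrightarrow> normal x \<bullet> y = 1 \<Longrightarrow> x = y"
  using power_sum_tangent_less[of x y] by (force simp: body_def)

lemma uminus_body: "x \<in> body \<Longrightarrow> - x \<in> body"
  by (simp add: body_def power_sum_def)

text \<open>By homogeneity, \<open>power_sum\<close> grows at least like its minimum on the unit sphere times \<open>norm x ^ (2 * r)\<close>, and that
  minimum is positive.\<close>

lemma compact_body: "compact body"
proof -
  obtain w :: 'a where "norm w = 1"
    using vector_choose_size[of 1] by auto
  then have "sphere (0::'a) 1 \<noteq> {}"
    by (auto simp: sphere_def dist_norm)
  then obtain u where "u \<in> sphere 0 1" "\<forall>x\<in>sphere 0 1. power_sum u \<le> power_sum x"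
    using continuous_attains_inf[OF compact_sphere _ continuous_power_sum] by blast
  then have u: "norm u = 1" "\<And>x. norm x = 1 \<Longrightarrow> power_sum u \<le> power_sum x"
    by (auto simp: sphere_def dist_norm)
  then have u_min: "norm x ^ (2 * r) * power_sum u \<le> power_sum x" for x
  proof -
    have "power_sum u \<le> power_sum (x /\<^sub>R norm x)" if "x \<noteq> 0"
      using that by (intro u(2)) simp
    then have "norm x ^ (2 * r) * power_sum u \<le> norm x ^ (2 * r) * power_sum (x /\<^sub>R norm x)" if "x \<noteq> 0"
      using that by (simp add: mult_left_mono)
    also have "norm x ^ (2 * r) * power_sum (x /\<^sub>R norm x) = power_sum x" if "x \<noteq> 0"
      using that by (simp flip: power_sum_scaleR)
    finally show ?thesis
      using r_pos by (cases "x = 0") (auto simp: power_sum_def power_0_left)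
  qed
  have Fu: "power_sum u > 0"
    using u(1) by (intro power_sum_pos) auto
  have "norm x \<le> max 1 (1 / power_sum u)" if "x \<in> body" for x
  proof (cases "norm x \<le> 1")
    case False
    then have "norm x \<le> norm x ^ (2 * r)"
      using r_pos by (intro self_le_power) auto
    also have "\<dots> \<le> 1 / power_sum u"
      using u_min[of x] that Fu by (simp add: body_def field_simps)
    finally show ?thesis by simp
  qed auto
  then have "bounded body"
    by (auto simp: bounded_iff)
  moreover have "closed body"
    unfolding body_def by (intro closed_Collect_le continuous_power_sum continuous_intros)
  ultimately show ?thesis
    by (simp add: compact_eq_bounded_closed)
qed

lemma interior_body: "interior body = {x. power_sum x < 1}"
proof
  have "open {x. power_sum x < 1}"
    by (intro open_Collect_less continuous_power_sum continuous_intros)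
  then show "{x. power_sum x < 1} \<subseteq> interior body"
    by (intro interior_maximal) (auto simp: body_def)
  show "interior body \<subseteq> {x. power_sum x < 1}"
  proof
    fix x assume x: "x \<in> interior body"
    show "x \<in> {x. power_sum x < 1}"
    proof (rule ccontr)
      assume "x \<notin> {x. power_sum x < 1}"
      then have 1: "power_sum x = 1"
        using x interior_subset by (force simp: body_def)
      then have "body \<subseteq> {y. normal x \<bullet> y \<le> 1}" "normal x \<noteq> 0"
        using normal_le_1[OF 1] normal_inner_self[of x] by auto
      then show False
        using halfspace_interior_less[OF _ _ x] normal_inner_self[of x] 1 by fastforce
    qed
  qed
qed

lemma frontier_body: "frontier body = {x. power_sum x = 1}"
  using compact_imp_closed[OF compact_body]
  by (auto simp: frontier_def interior_body) (auto simp: body_def)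

lemma convex_body_body: "convex_body body"
proof -
  have "convex body"
    unfolding convex_alt
  proof (intro ballI allI impI)
    fix x y :: 'a and s :: real
    assume xy: "x \<in> body" "y \<in> body" and s: "0 \<le> s \<and> s \<le> 1"
    define z where "z = (1 - s) *\<^sub>R x + s *\<^sub>R y"
    have le: "2 * real r * (normal z \<bullet> w) \<le> (2 * real r - 1) * power_sum z + 1" if "w \<in> body" for w
    proof (cases "z = w")
      case True
      then show ?thesis
        using that by (simp add: normal_inner_self body_def algebra_simps)
    next
      case False
      then show ?thesis
        using that power_sum_tangent_less[of z w] by (simp add: body_def)
    qed
    have "2 * real r * power_sum z = (1 - s) * (2 * real r * (normal z \<bullet> x)) + s * (2 * real r * (normal z \<bullet> y))"
      by (subst normal_inner_self[symmetric], subst (2) z_def) (simp add: inner_add_right algebra_simps)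
    also have "\<dots> \<le> (1 - s) * ((2 * real r - 1) * power_sum z + 1) + s * ((2 * real r - 1) * power_sum z + 1)"
      using s le xy by (intro add_mono mult_left_mono) auto
    also have "\<dots> = (2 * real r - 1) * power_sum z + 1"
      by (simp add: algebra_simps)
    finally show "(1 - s) *\<^sub>R x + s *\<^sub>R y \<in> body"
      by (simp add: z_def body_def algebra_simps)
  qed
  moreover have "0 \<in> interior body"
    using r_pos by (simp add: interior_body power_sum_def power_0_left)
  ultimately show ?thesis
    using compact_body by (auto simp: convex_body_def)
qed

lemma strictly_convex_body_body: "strictly_convex_body body"
  unfolding strictly_convex_body_def
proof (intro conjI convex_body_body notI)
  assume "\<exists>x y. x \<noteq> y \<and> closed_segment x y \<subseteq> frontier body"
  then obtain x y where xy: "x \<noteq> y" and seg: "closed_segment x y \<subseteq> frontier body"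
    by blast
  define z where "z = midpoint x y"
  have F1: "power_sum x = 1" "power_sum y = 1" "power_sum z = 1"
    using seg ends_in_segment[of x y] midpoint_in_closed_segment[of x y]
    by (auto simp: frontier_body z_def simp del: midpoint_in_closed_segment)
  have "normal z \<bullet> z = (normal z \<bullet> x + normal z \<bullet> y) / 2"
    by (subst (2) z_def) (simp add: midpoint_def inner_add_right)
  moreover have "normal z \<bullet> x \<le> 1" "normal z \<bullet> y \<le> 1"
    using normal_le_1 F1 by (auto simp: body_def)
  ultimately have "normal z \<bullet> x = 1"
    using F1(3) by (simp add: normal_inner_self)
  then have "z = x"
    using normal_eq_1 F1 by (simp add: body_def)
  then show False
    using xy by (simp add: z_def)
qed

text \<open>Uniqueness of the supporting hyperplane. A small step from \<open>x\<close> in a direction \<open>h\<close> with \<open>normal x \<bullet> h < 0\<close> stays in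
  the body, so \<open>a \<bullet> h \<le> 0\<close>. The component \<open>w\<close> of \<open>a\<close> orthogonal to the normal is a limit of such directions, whence
  \<open>w \<bullet> w = a \<bullet> w \<le> 0\<close>.\<close>

lemma supporting_normal_parallel:
  assumes x: "power_sum x = 1" and a: "a \<bullet> x = b" "body \<subseteq> {y. a \<bullet> y \<le> b}"
  shows "a = b *\<^sub>R normal x"
proof -
  let ?n = "normal x"
  have descent: "a \<bullet> h \<le> 0" if h: "?n \<bullet> h < 0" for h
  proof -
    have "((\<lambda>t. power_sum (x + t *\<^sub>R h)) has_real_derivative 2 * real r * (?n \<bullet> h)) (at 0)"
      unfolding power_sum_def normal_inner
      by (auto intro!: derivative_eq_intros sum.cong simp: inner_add_right sum_distrib_left)
    moreover have "2 * real r * (?n \<bullet> h) < 0"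
      using h r_pos by (simp add: mult_pos_neg)
    ultimately have "\<exists>d>0. \<forall>t>0. t < d \<longrightarrow> power_sum (x + (0 + t) *\<^sub>R h) < power_sum (x + 0 *\<^sub>R h)"
      by (rule DERIV_neg_dec_right)
    then obtain d where d: "d > 0" "\<And>t. 0 < t \<Longrightarrow> t < d \<Longrightarrow> power_sum (x + t *\<^sub>R h) < power_sum x"
      by auto
    have "x + (d / 2) *\<^sub>R h \<in> body"
      using d(2)[of "d / 2"] d(1) x by (simp add: body_def)
    then have "a \<bullet> (x + (d / 2) *\<^sub>R h) \<le> b"
      using a(2) by auto
    then show ?thesis
      using a(1) d(1) by (simp add: inner_add_right mult_le_0_iff)
  qed
  have nn: "?n \<bullet> ?n > 0"
    using x normal_inner_self[of x] by auto
  define w where "w = a - (a \<bullet> ?n / (?n \<bullet> ?n)) *\<^sub>R ?n"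
  have wn: "?n \<bullet> w = 0"
    using nn by (simp add: w_def inner_diff_right inner_commute)
  have small: "a \<bullet> w \<le> e * (a \<bullet> ?n)" if "e > 0" for e
  proof -
    have "?n \<bullet> (w - e *\<^sub>R ?n) < 0"
      using wn nn that by (simp add: inner_diff_right)
    then show ?thesis
      using descent by (fastforce simp: inner_diff_right)
  qed
  have "a \<bullet> w \<le> 0"
  proof (rule field_le_epsilon)
    fix e :: real assume "e > 0"
    define d where "d = e / (\<bar>a \<bullet> ?n\<bar> + 1)"
    have "d > 0"
      using \<open>e > 0\<close> by (simp add: d_def)
    have "a \<bullet> w \<le> d * (a \<bullet> ?n)"
      using small \<open>d > 0\<close> .
    also have "\<dots> \<le> d * (\<bar>a \<bullet> ?n\<bar> + 1)"
      using \<open>d > 0\<close> by (intro mult_left_mono) auto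
    also have "\<dots> = e"
      by (simp add: d_def)
    finally show "a \<bullet> w \<le> 0 + e" by simp
  qed
  moreover have "a \<bullet> w = w \<bullet> w"
    using wn by (subst (2) w_def) (simp add: inner_diff_left)
  ultimately have "w = 0"
    by (metis inner_eq_zero_iff inner_ge_zero order_antisym)
  then obtain c where c: "a = c *\<^sub>R ?n"
    by (auto simp: w_def)
  then have "c = b"
    using a(1) x by (simp add: normal_inner_self)
  then show ?thesis
    using c by simp
qed

lemma smooth_body_body: "smooth_body body"
  unfolding smooth_body_def
proof (intro conjI convex_body_body ballI)
  fix x assume "x \<in> frontier body"
  then have x: "power_sum x = 1"
    by (simp add: frontier_body)
  show "\<exists>!H. supporting_hyperplane_at body x H"
  proof (rule ex1I)
    show "supporting_hyperplane_at body x {y. normal x \<bullet> y = 1}"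
      unfolding supporting_hyperplane_at_def
      using normal_le_1[OF x] normal_inner_self[of x] x
      by (intro exI[of _ "normal x"] exI[of _ 1]) auto
  next
    fix H assume "supporting_hyperplane_at body x H"
    then obtain a b where a: "a \<noteq> 0" "H = {y. a \<bullet> y = b}" "a \<bullet> x = b" "body \<subseteq> {y. a \<bullet> y \<le> b}"
      by (auto simp: supporting_hyperplane_at_def)
    then have "a = b *\<^sub>R normal x"
      using supporting_normal_parallel[OF x] by blast
    then show "H = {y. normal x \<bullet> y = 1}"
      using a(1,2) by auto
  qed
qed

text \<open>Rescaling the points to the boundary changes their normals only by positive factors.\<close>

theorem card_le_H_sep_body:
  assumes fin: "finite J" and nz: "\<And>j. j \<in> J \<Longrightarrow> u j \<noteq> 0"
    and obtuse: "\<And>i j. i \<in> J \<Longrightarrow> j \<in> J \<Longrightarrow> i \<noteq> j \<Longrightarrow> normal (u j) \<bullet> u i \<le> 0"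
  shows "enat (card J) \<le> H_sep body"
proof -
  define c where "c j = inverse (root (2 * r) (power_sum (u j)))" for j
  have c_pos: "c j > 0" if "j \<in> J" for j
    using power_sum_pos[OF nz[OF that]] r_pos by (simp add: c_def)
  have F1: "power_sum (c j *\<^sub>R u j) = 1" if "j \<in> J" for j
    using power_sum_pos[OF nz[OF that]] r_pos
    by (simp add: power_sum_scaleR c_def power_inverse real_root_pow_pos2)
  show ?thesis
  proof (rule card_le_H_sep)
    show "strictly_convex_body body" "finite J"
      by (fact strictly_convex_body_body fin)+
    show "- x \<in> body" if "x \<in> body" for x
      using that by (rule uminus_body)
    show "c j *\<^sub>R u j \<in> body" "normal (c j *\<^sub>R u j) \<bullet> (c j *\<^sub>R u j) = 1" if "j \<in> J" for j
      using F1[OF that] by (simp_all only: body_def normal_inner_self mem_Collect_eq order_refl)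
    show "normal (c j *\<^sub>R u j) \<bullet> x \<le> 1" if "j \<in> J" "x \<in> body" for j x
      using normal_le_1 F1 that by blast
    show "normal (c j *\<^sub>R u j) \<bullet> (c i *\<^sub>R u i) \<le> 0" if "i \<in> J" "j \<in> J" "i \<noteq> j" for i j
      using obtuse[OF that] c_pos[OF that(1)] c_pos[OF that(2)]
      by (simp add: normal_scaleR mult_le_0_iff)
  qed
qed

end

section \<open>Bodies with prescribed approximate normals\<close>

text \<open>The term has the sign of \<open>x * y\<close>, since the exponent is odd. Only a positive one has to decay.\<close>

lemma eventually_power_term_le:
  fixes x y d :: real
  assumes "x * y > 0 \<Longrightarrow> \<bar>x\<bar> < 1 \<and> d > 0" "d \<ge> 0"
  shows "\<forall>\<^sub>F s in sequentially. x ^ (2 * Suc s - 1) * y \<le> d"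
proof -
  have eq: "x ^ (2 * Suc s - 1) * y = (x\<^sup>2) ^ s * (x * y)" for s
    by (simp add: power_mult)
  show ?thesis
  proof (cases "x * y > 0")
    case True
    then have "x\<^sup>2 < 1"
      using assms(1) by (simp add: abs_square_less_1)
    then have "(\<lambda>s. (x\<^sup>2) ^ s * (x * y)) \<longlonglongrightarrow> 0 * (x * y)"
      by (intro tendsto_mult tendsto_const LIMSEQ_realpow_zero) auto
    then have "\<forall>\<^sub>F s in sequentially. (x\<^sup>2) ^ s * (x * y) < d"
      using True assms(1) by (intro order_tendstoD(2)) auto
    then show ?thesis
      unfolding eq by eventually_elim simp
  next
    case False
    then have "(x\<^sup>2) ^ s * (x * y) \<le> d" for s
      using assms(2) mult_nonneg_nonpos[of "(x\<^sup>2) ^ s" "x * y"] by auto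
    then show ?thesis
      unfolding eq by simp
  qed
qed

text \<open>The inner product of the normal at \<open>v\<^sub>j\<close> with \<open>v\<^sub>i\<close> is \<open>g\<^sub>j \<bullet> v\<^sub>i\<close> plus one perturbing term for every other form.
  Positive perturbations tend to 0 and are absorbed by a negative \<open>g\<^sub>j \<bullet> v\<^sub>i\<close>. If \<open>g\<^sub>j \<bullet> v\<^sub>i = 0\<close>, there is no room for
  them, and the last two assumptions say that there are none. This generality serves families in which
  mutually orthogonal parts, and antipodal pairs with \<open>g\<^sub>j \<bullet> v\<^sub>i = -1\<close>, occur together. The assumption on \<open>Basis\<close>
  arises because small multiples of the coordinate functions are added to the forms to make them span.\<close>

theorem obtuse_family_H_sep:
  fixes v g :: "'j \<Rightarrow> 'a::euclidean_space"
  assumes fin: "finite J"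
    and diag: "\<And>j. j \<in> J \<Longrightarrow> g j \<bullet> v j = 1"
    and obtuse: "\<And>i j. i \<in> J \<Longrightarrow> j \<in> J \<Longrightarrow> i \<noteq> j \<Longrightarrow> g j \<bullet> v i \<le> 0"
    and link: "\<And>i j k. i \<in> J \<Longrightarrow> j \<in> J \<Longrightarrow> k \<in> J \<Longrightarrow> i \<noteq> j \<Longrightarrow> k \<noteq> i \<Longrightarrow> k \<noteq> j \<Longrightarrow>
      (g k \<bullet> v j) * (g k \<bullet> v i) > 0 \<Longrightarrow> \<bar>g k \<bullet> v j\<bar> < 1 \<and> g j \<bullet> v i < 0"
    and link_Basis: "\<And>i j b. i \<in> J \<Longrightarrow> j \<in> J \<Longrightarrow> b \<in> Basis \<Longrightarrow> i \<noteq> j \<Longrightarrow>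
      (b \<bullet> v j) * (b \<bullet> v i) > 0 \<Longrightarrow> g j \<bullet> v i < 0"
  shows "\<exists>K :: 'a set. smooth_body K \<and> strictly_convex_body K \<and> enat (card J) \<le> H_sep K"
proof -
  \<comment> \<open>The factor that brings all coordinate functions below 1 at the given points, so that their
        powers vanish in the limit like those of the \<open>g k\<close>.\<close>
  define e where "e = 1 / (1 + (\<Sum>j\<in>J. norm (v j)))"
  have sum_nonneg: "0 \<le> (\<Sum>j\<in>J. norm (v j))"
    by (simp add: sum_nonneg)
  then have e_pos: "e > 0"
    by (simp add: e_def)
  have e_small: "\<bar>e * (b \<bullet> v j)\<bar> < 1" if "j \<in> J" "b \<in> Basis" for j b
  proof -
    have "\<bar>b \<bullet> v j\<bar> \<le> norm (v j)"
      using Basis_le_norm[OF that(2), of "v j"] by (simp add: inner_commute)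
    also have "\<dots> \<le> (\<Sum>j\<in>J. norm (v j))"
      using that fin by (intro member_le_sum) auto
    finally show ?thesis
      using sum_nonneg by (simp add: e_def abs_mult)
  qed
  define h where "h = case_sum g (\<lambda>b. e *\<^sub>R b)"
  define I where "I = J <+> (Basis :: 'a set)"
  have fin_I: "finite I"
    using fin by (simp add: I_def)
  have span: "x = 0" if "\<And>k. k \<in> I \<Longrightarrow> h k \<bullet> x = 0" for x
  proof (rule euclidean_eqI)
    fix b :: 'a assume "b \<in> Basis"
    then show "x \<bullet> b = 0 \<bullet> b"
      using that[of "Inr b"] e_pos by (simp add: I_def h_def inner_commute InrI)
  qed
  have ev: "\<forall>\<^sub>F s in sequentially. (\<Sum>k\<in>I. (h k \<bullet> v j) ^ (2 * Suc s - 1) * (h k \<bullet> v i)) \<le> 0"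
    if ij: "i \<in> J" "j \<in> J" "i \<noteq> j" for i j
  proof -
    define a where "a = g j \<bullet> v i"
    define d where "d = - a / card I"
    have jI: "Inl j \<in> I"
      using ij by (simp add: I_def InlI)
    then have card_pos: "card I > 0"
      using fin_I by (simp add: card_gt_0_iff) blast
    have d0: "d \<ge> 0" "a < 0 \<Longrightarrow> d > 0"
      using obtuse[OF ij] card_pos by (auto simp: d_def a_def divide_neg_pos divide_nonpos_pos)
    have "\<forall>\<^sub>F s in sequentially. (h k \<bullet> v j) ^ (2 * Suc s - 1) * (h k \<bullet> v i) \<le> d"
      if k: "k \<in> I - {Inl j}" for k
    proof (rule eventually_power_term_le[OF _ d0(1)])
      assume pos: "(h k \<bullet> v j) * (h k \<bullet> v i) > 0"
      consider b where "k = Inr b" "b \<in> Basis" | k' where "k = Inl k'" "k' \<in> J" "k' \<noteq> j"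
        using k by (auto simp: I_def)
      then show "\<bar>h k \<bullet> v j\<bar> < 1 \<and> d > 0"
      proof cases
        case 1
        then have "(e * e) * ((b \<bullet> v j) * (b \<bullet> v i)) > 0"
          using pos by (simp add: h_def algebra_simps)
        then have "(b \<bullet> v j) * (b \<bullet> v i) > 0"
          using e_pos by (simp add: zero_less_mult_iff)
        then show ?thesis
          using link_Basis[OF ij(1,2) 1(2) ij(3)] e_small[OF ij(2) 1(2)] 1 d0(2)
          by (simp add: h_def a_def)
      next
        case 2
        have "k' \<noteq> i"
        proof
          assume "k' = i"
          then have "g i \<bullet> v j > 0"
            using pos 2 diag[OF ij(1)] by (simp add: h_def)
          then show False
            using obtuse[OF ij(2,1)] ij(3) by auto
        qed
        then show ?thesis
          using link[OF ij(1,2) 2(2) ij(3) _ 2(3)] pos 2 d0(2) by (simp add: h_def a_def)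
      qed
    qed
    then have "\<forall>\<^sub>F s in sequentially. \<forall>k\<in>I - {Inl j}. (h k \<bullet> v j) ^ (2 * Suc s - 1) * (h k \<bullet> v i) \<le> d"
      using fin_I by (intro eventually_ball_finite) auto
    then show ?thesis
    proof eventually_elim
      case (elim s)
      have "(\<Sum>k\<in>I. (h k \<bullet> v j) ^ (2 * Suc s - 1) * (h k \<bullet> v i))
          = a + (\<Sum>k\<in>I - {Inl j}. (h k \<bullet> v j) ^ (2 * Suc s - 1) * (h k \<bullet> v i))"
        using fin_I jI diag[OF ij(2)] by (simp add: sum.remove h_def a_def)
      also have "\<dots> \<le> a + real (card (I - {Inl j})) * d"
        using elim by (intro add_left_mono sum_bounded_above) auto
      also have "\<dots> \<le> a + real (card I) * d"
        using d0(1) fin_I by (intro add_left_mono mult_right_mono) (auto intro: card_mono)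
      also have "\<dots> = 0"
        using card_pos by (simp add: d_def)
      finally show ?case .
    qed
  qed
  have "\<forall>\<^sub>F s in sequentially. i \<noteq> j \<longrightarrow>
      (\<Sum>k\<in>I. (h k \<bullet> v j) ^ (2 * Suc s - 1) * (h k \<bullet> v i)) \<le> 0" if "i \<in> J" "j \<in> J" for i j
    using ev[OF that] by (cases "i = j") auto
  then have "\<forall>\<^sub>F s in sequentially. \<forall>i\<in>J. \<forall>j\<in>J. i \<noteq> j \<longrightarrow>
      (\<Sum>k\<in>I. (h k \<bullet> v j) ^ (2 * Suc s - 1) * (h k \<bullet> v i)) \<le> 0"
    using fin by (intro eventually_ball_finite ballI) auto
  then obtain s where s: "\<And>i j. i \<in> J \<Longrightarrow> j \<in> J \<Longrightarrow> i \<noteq> j \<Longrightarrow>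
      (\<Sum>k\<in>I. (h k \<bullet> v j) ^ (2 * Suc s - 1) * (h k \<bullet> v i)) \<le> 0"
    unfolding eventually_sequentially by blast
  interpret power_body h I "Suc s"
    using fin_I span by unfold_locales auto
  have "enat (card J) \<le> H_sep body"
  proof (rule card_le_H_sep_body[OF fin])
    show "v j \<noteq> 0" if "j \<in> J" for j
      using diag[OF that] by auto
    show "normal (v j) \<bullet> v i \<le> 0" if "i \<in> J" "j \<in> J" "i \<noteq> j" for i j
      unfolding normal_inner by (rule s[OF that])
  qed
  then show ?thesis
    using smooth_body_body strictly_convex_body_body by blast
qed

section \<open>Integer point sets with a Lorentzian obtuseness condition\<close>

definition dot :: "int list \<Rightarrow> int list \<Rightarrow> int"
  where "dot x y = sum_list (map2 (*) x y)"

text \<open>The condition for the points \<open>(x, 1)\<close> and \<open>(y, 1)\<close> with the functionals \<open>(x, -T)\<close> and \<open>(y, -T)\<close>: the value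
  \<open>dot x y - T\<close> is negative and smaller in modulus than the diagonal values \<open>dot x x - T\<close> and \<open>dot y y - T\<close>.\<close>

definition apart :: "int \<Rightarrow> int list \<Rightarrow> int list \<Rightarrow> bool"
  where "apart T x y \<longleftrightarrow> dot x y < T \<and> 2 * T - dot x x < dot x y \<and> 2 * T - dot y y < dot x y"

lemma dot_eq_sum:
  "length x = length y \<Longrightarrow> dot x y = (\<Sum>k<length x. x ! k * y ! k)"
  by (simp add: dot_def sum_list_sum_nth atLeast0LessThan)

lemma dot_commute: "length x = length y \<Longrightarrow> dot x y = dot y x"
  by (simp add: dot_eq_sum mult.commute)

lemma dot_snoc: "length x = length y \<Longrightarrow> dot (x @ [a]) (y @ [b]) = dot x y + a * b"
  by (simp add: dot_def)

lemma apart_commute: "length x = length y \<Longrightarrow> apart T x y \<Longrightarrow> apart T y x"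
  by (auto simp: apart_def dot_commute)

text \<open>Of the \<open>CARD('n)\<close> coordinates, the first \<open>m\<close> carry the integer points, the next one is the homogenizing coordinate,
  and each of the remaining ones (the set \<open>E\<close> below) supports the two opposite unit vectors of its axis, every
  one of them being its own functional.\<close>

theorem separated_integer_points_H_sep:
  assumes len: "\<And>x. x \<in> set X \<Longrightarrow> length x = m" and m: "m < CARD('n::finite)"
    and norm: "\<And>x. x \<in> set X \<Longrightarrow> T < dot x x"
    and apart: "sorted_wrt (apart T) X"
  shows "\<exists>K :: (real ^ 'n) set. smooth_body K \<and> strictly_convex_body K \<and>
    enat (length X + 2 * (CARD('n) - Suc m)) \<le> H_sep K"
proof -
  obtain idx :: "'n \<Rightarrow> nat" where idx: "bij_betw idx UNIV {0..<CARD('n)}"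
    using ex_bij_betw_finite_nat[OF finite] by blast
  have idx_less: "idx i < CARD('n)" for i
    using bij_betw_apply[OF idx, of i] by simp
  define vec :: "int list \<Rightarrow> real ^ 'n"
    where "vec l = (\<chi> i. if idx i < length l then real_of_int (l ! idx i) else 0)" for l
  have vec_inner: "vec x \<bullet> vec y = real_of_int (dot x y)"
    if "length x = Suc m" "length y = Suc m" for x y
  proof -
    have "vec x \<bullet> vec y
        = (\<Sum>i\<in>UNIV. (\<lambda>k. if k < Suc m then real_of_int (x ! k * y ! k) else 0) (idx i))"
      using that by (auto simp: vec_def inner_vec_def intro!: sum.cong)
    also have "\<dots> = (\<Sum>k\<in>{0..<CARD('n)}. if k < Suc m then real_of_int (x ! k * y ! k) else 0)"
      by (rule sum.reindex_bij_betw[OF idx])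
    also have "\<dots> = (\<Sum>k<Suc m. real_of_int (x ! k * y ! k))"
      using m by (intro sum.mono_neutral_cong_right) auto
    finally show ?thesis
      using that by (simp add: dot_eq_sum del: sum.lessThan_Suc)
  qed
  define E where "E = {i. m < idx i}"
  have "idx ` E = {Suc m..<CARD('n)}"
    using idx by (auto simp: E_def bij_betw_def image_iff set_eq_iff Suc_le_eq) metis
  moreover have "inj_on idx E"
    using idx by (auto simp: bij_betw_def inj_on_def)
  ultimately have card_E: "card E = CARD('n) - Suc m"
    using card_image by fastforce
  define sign :: "bool \<Rightarrow> real" where "sign s = (if s then 1 else - 1)" for s
  define pole :: "'n \<times> bool \<Rightarrow> real ^ 'n" where "pole p = axis (fst p) (sign (snd p))" for p
  define v where "v = case_sum (\<lambda>k. vec (X ! k @ [1])) pole"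
  define g where "g = case_sum (\<lambda>k. (1 / (dot (X ! k) (X ! k) - T)) *\<^sub>R vec (X ! k @ [- T])) pole"
  define J where "J = {..<length X} <+> (E \<times> (UNIV :: bool set))"
  have len': "length (X ! k) = m" if "k < length X" for k
    using len that by simp
  have gv_points: "g (Inl k) \<bullet> v (Inl l) = (dot (X ! k) (X ! l) - T) / (dot (X ! k) (X ! k) - T)"
    if "k < length X" "l < length X" for k l
    using that len' by (simp add: g_def v_def vec_inner dot_snoc)
  have vec_pole: "vec (x @ [a]) \<bullet> pole p = 0" if "length x = m" "fst p \<in> E" for x a p
    using that by (simp add: pole_def inner_axis vec_def E_def)
  have gv_mixed: "g (Inl k) \<bullet> v (Inr p) = 0" "g (Inr p) \<bullet> v (Inl k) = 0"
    if "k < length X" "p \<in> E \<times> UNIV" for k p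
    using that vec_pole len' by (auto simp: g_def v_def inner_commute[of "pole _"])
  have gv_poles: "g (Inr p) \<bullet> v (Inr q) = (if fst p = fst q then sign (snd p) * sign (snd q) else 0)"
    for p q
    by (simp add: g_def v_def pole_def inner_axis_axis)
  have norm': "real_of_int T < dot (X ! k) (X ! k)" if "k < length X" for k
    using norm that by simp
  have apart': "apart T (X ! k) (X ! l)" if "k < length X" "l < length X" "k \<noteq> l" for k l
    using that apart apart_commute len' by (metis linorder_neqE_nat sorted_wrt_nth_less)
  have strict: "g (Inl k) \<bullet> v (Inl l) < 0" "\<bar>g (Inl k) \<bullet> v (Inl l)\<bar> < 1"
    if kl: "k < length X" "l < length X" "k \<noteq> l" for k l
  proof -
    let ?D = "real_of_int (dot (X ! k) (X ! k))" and ?d = "real_of_int (dot (X ! k) (X ! l))"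
    have "?d < T" "2 * T - ?D < ?d"
      using apart'[OF kl] unfolding apart_def by linarith+
    then show "g (Inl k) \<bullet> v (Inl l) < 0" "\<bar>g (Inl k) \<bullet> v (Inl l)\<bar> < 1"
      using norm'[OF kl(1)] kl by (simp_all add: gv_points abs_less_iff field_simps)
  qed
  have "\<exists>K :: (real ^ 'n) set. smooth_body K \<and> strictly_convex_body K \<and> enat (card J) \<le> H_sep K"
  proof (rule obtuse_family_H_sep)
    show "finite J"
      by (simp add: J_def)
    show "g j \<bullet> v j = 1" if "j \<in> J" for j
      using that norm' by (auto simp: J_def gv_points gv_poles sign_def) (smt (verit))
    show "g j \<bullet> v i \<le> 0" if "i \<in> J" "j \<in> J" "i \<noteq> j" for i j
      using that strict(1) gv_mixed
      by (cases i; cases j) (auto simp: J_def gv_poles sign_def less_imp_le)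
  next
    fix i j k
    assume ijk: "i \<in> J" "j \<in> J" "k \<in> J" "i \<noteq> j" "k \<noteq> i" "k \<noteq> j"
      and pos: "(g k \<bullet> v j) * (g k \<bullet> v i) > 0"
    then show "\<bar>g k \<bullet> v j\<bar> < 1 \<and> g j \<bullet> v i < 0"
      using strict gv_mixed
      by (cases i; cases j; cases k) (auto simp: J_def gv_poles sign_def split: if_splits)
  next
    fix i j and b :: "real ^ 'n"
    assume ij: "i \<in> J" "j \<in> J" "b \<in> Basis" "i \<noteq> j" and pos: "(b \<bullet> v j) * (b \<bullet> v i) > 0"
    then obtain t where b: "b = axis t 1"
      by (auto simp: Basis_vec_def)
    have bv: "b \<bullet> v (Inl k) = vec (X ! k @ [1]) $ t" "b \<bullet> v (Inr p) = (if fst p = t then sign (snd p) else 0)"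
      for k p
      by (simp add: b v_def inner_axis', simp add: b v_def pole_def inner_axis_axis)
    have 0: "b \<bullet> v (Inl k) = 0" if "k < length X" "t \<in> E" for k
      using that len' by (simp add: bv vec_def E_def)
    show "g j \<bullet> v i < 0"
    proof (cases "t \<in> E")
      case True
      then obtain p q where "i = Inr p" "j = Inr q"
        using ij pos 0 by (auto simp: J_def)
      then show ?thesis
        using ij(4) pos by (cases p; cases q) (auto simp: bv gv_poles sign_def split: if_splits)
    next
      case False
      then have "b \<bullet> v (Inr p) = 0" if "Inr p \<in> J" for p
        using that by (auto simp: J_def bv)
      then obtain k l where "i = Inl k" "j = Inl l"
        using ij pos by (cases i; cases j) auto
      then show ?thesis
        using ij strict(1) by (auto simp: J_def)
    qed
  qed
  moreover have "card J = length X + 2 * (CARD('n) - Suc m)"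
    unfolding J_def by (subst card_Plus) (auto simp: card_E card_cartesian_product)
  ultimately show ?thesis
    by simp
qed

definition separated :: "nat \<Rightarrow> int \<Rightarrow> int list list \<Rightarrow> bool"
  where "separated m T X \<longleftrightarrow> (\<forall>x\<in>set X. length x = m \<and> T < dot x x) \<and> sorted_wrt (apart T) X"

section \<open>The point sets\<close>

text \<open>A vector is given as a list of blocks, and a generator of the cyclic group rotates all blocks at once.
  The length of every block is to divide \<open>n\<close>; a block of length 1 is fixed.\<close>

definition rotations :: "nat \<Rightarrow> int list list \<Rightarrow> int list list"
  where "rotations n bs = map (\<lambda>s. concat (map (rotate s) bs)) [0..<n]"

text \<open>In each set the index is the dimension \<open>d\<close> in which it is used; its points lie in \<open>\<int>\<^bsup>d-1\<^esup>\<close>. The sets consist of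
  orbits of a cyclic group that permutes coordinates, with one additional fixed point for \<open>d = 9\<close>. Their
  entries are rounded approximate real solutions of the inequalities \<open>apart\<close>. The inequalities are strict, which
  leaves room for rounding. The values of \<open>T\<close> are between 0.15 and 0.3 times the squared norms.\<close>

definition config8 :: "int list list"
  where "config8 = concat (map (rotations 3)
   [[[-7, -6, 2], [1, -4, 6], [-5]],
    [[-6, 1, -8], [4, -6, 0], [4]],
    [[-7, 6, 4], [-2, -5, -6], [-4]],
    [[3, 5, 2], [9, -5, 3], [-4]],
    [[6, 4, -7], [4, 6, 3], [4]],
    [[1, 1, 5], [-3, -9, 4], [6]]])"

lemma config8: "length config8 = 18" "separated 7 29 config8"
  by code_simp+

definition config9 :: "int list list"
  where "config9 = concat (map (rotations 4)
   [[[-2, 61, -35, -25], [-10, -2, 16, -6]],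
    [[17, -11, 50, 39], [-21, 30, 9, 12]],
    [[32, 15, 25, -17], [-42, -28, 18, -31]],
    [[-51, 2, -28, -16], [7, -17, 2, 45]],
    [[4, -27, 7, 12], [18, 2, 36, -59]],
    [[5, 22, -36, 13], [55, -2, -30, -8]],
    [[-2, -14, -52, 8], [-24, -44, 8, -20]]]) @
   [[1, 1, 1, 1, 39, 39, 39, 39]]"

lemma config9: "length config9 = 29" "separated 8 1374 config9"
  by code_simp+

definition config10 :: "int list list"
  where "config10 = concat (map (rotations 3)
   [[[3, -21, -1], [-7, -33, 22], [-35, -5, 28]],
    [[0, 17, 14], [11, 21, 5], [44, -11, 32]],
    [[-36, 18, 35], [17, 13, -10], [0, 27, 9]],
    [[19, -1, 18], [-43, 1, 11], [-27, -21, -17]],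
    [[-24, -6, -36], [10, -12, 32], [1, -31, -5]],
    [[-12, -42, 16], [-11, -10, 35], [4, 3, -23]],
    [[-2, -17, 5], [27, 31, -34], [-10, -8, 29]],
    [[11, 2, -12], [9, -23, -29], [14, 27, -39]],
    [[1, 31, -19], [-42, -13, -25], [12, -8, -8]],
    [[14, 13, 45], [11, -12, 37], [-1, -8, 8]],
    [[39, 0, -27], [-23, 16, -8], [-7, 31, -1]],
    [[-39, 4, -4], [-6, -14, 4], [46, 6, -14]],
    [[23, 3, -14], [11, 12, 35], [-18, 3, -40]]])"

lemma config10: "length config10 = 39" "separated 9 1223 config10"
  by code_simp+

definition config11 :: "int list list"
  where "config11 = concat (map (rotations 10)
   [[[-5, 22, 10, -20, -3, 8, 6, 17, 15, 7]],
    [[8, -25, 24, 4, 11, -6, -3, -15, -1, -1]],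
    [[-19, 10, -13, -4, 20, -6, 11, 18, -11, 7]],
    [[-17, 0, -21, -9, -4, 3, 5, 3, 13, -25]],
    [[4, -20, -20, 1, 26, 0, -8, -4, 9, -3]]])"

lemma config11: "length config11 = 50" "separated 10 428 config11"
  by code_simp+

definition config12 :: "int list list"
  where "config12 = concat (map (rotations 11)
   [[[33, -3, -41, 14, 61, 6, 7, 13, 0, -11, -40]],
    [[8, 6, 1, -15, 43, 30, 9, -5, -59, -34, 29]],
    [[18, 18, -56, 16, -10, 57, -31, -13, 4, -12, 4]],
    [[36, -30, -32, -21, -5, -23, -42, -43, -4, 11, -27]],
    [[-8, -32, -18, -22, 32, 19, 43, 33, 29, -31, 25]],
    [[21, -38, 26, -2, 13, 68, -25, 27, 0, 0, 7]]])"

lemma config12: "length config12 = 66" "separated 11 2460 config12"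
  by code_simp+

definition config14 :: "int list list"
  where "config14 = concat (map (rotations 13)
   [[[-9, 16, -19, 8, 5, -1, 17, -3, -8, 2, 11, 15, -20]],
    [[-9, 20, -2, -3, -13, -11, -9, 7, 8, 22, -8, 8, -17]],
    [[21, -3, -23, 0, -6, -12, -15, 6, -16, -13, -5, -3, 2]],
    [[0, 20, -1, 6, 16, -6, -6, 11, 10, -14, 18, -18, 8]],
    [[-22, -11, -7, 21, -13, 6, 5, 10, -8, 0, -18, 4, -9]],
    [[10, 24, 17, 1, 0, -5, 13, -8, 0, 11, 12, -12, -15]],
    [[3, -7, 9, 4, 4, 25, 0, 23, 10, -14, -11, -12, -4]]])"

lemma config14: "length config14 = 91" "separated 13 541 config14"
  by code_simp+

text \<open>Surplus dimensions beyond \<open>Suc m\<close> are used up by the coordinate axes.\<close>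

lemma separated_H_sep:
  assumes "separated m T X" "m < CARD('n::finite)" "N \<le> length X + 2 * (CARD('n) - Suc m)"
  shows "\<exists>K :: (real ^ 'n) set. smooth_body K \<and> strictly_convex_body K \<and> enat N \<le> H_sep K"
proof -
  have "\<exists>K :: (real ^ 'n) set. smooth_body K \<and> strictly_convex_body K \<and>
      enat (length X + 2 * (CARD('n) - Suc m)) \<le> H_sep K"
    using assms(1,2) by (intro separated_integer_points_H_sep) (auto simp: separated_def)
  then show ?thesis
    using assms(3) by (meson enat_ord_simps(1) order_trans)
qed

theorem theorem1:
  "(CARD('n::finite) \<ge> 8 \<longrightarrow>
      (\<exists>K :: (real ^ 'n) set. smooth_body K \<and> strictly_convex_body K \<and>
         H_sep K \<ge> enat (2 * CARD('n) + 2))) \<and>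
   (CARD('n) = 9 \<longrightarrow>
      (\<exists>K :: (real ^ 'n) set. smooth_body K \<and> strictly_convex_body K \<and> H_sep K \<ge> 29)) \<and>
   (CARD('n) = 10 \<longrightarrow>
      (\<exists>K :: (real ^ 'n) set. smooth_body K \<and> strictly_convex_body K \<and> H_sep K \<ge> 39)) \<and>
   (CARD('n) = 11 \<longrightarrow>
      (\<exists>K :: (real ^ 'n) set. smooth_body K \<and> strictly_convex_body K \<and> H_sep K \<ge> 50)) \<and>
   (CARD('n) = 12 \<longrightarrow>
      (\<exists>K :: (real ^ 'n) set. smooth_body K \<and> strictly_convex_body K \<and> H_sep K \<ge> 65)) \<and>
   (CARD('n) = 14 \<longrightarrow>
      (\<exists>K :: (real ^ 'n) set. smooth_body K \<and> strictly_convex_body K \<and> H_sep K \<ge> 91))"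
proof (intro conjI impI)
  assume "CARD('n) \<ge> 8"
  then show "\<exists>K :: (real ^ 'n) set. smooth_body K \<and> strictly_convex_body K \<and>
      H_sep K \<ge> enat (2 * CARD('n) + 2)"
    by (intro separated_H_sep[OF config8(2)]) (simp_all add: config8(1))
next
  assume "CARD('n) = 9"
  then show "\<exists>K :: (real ^ 'n) set. smooth_body K \<and> strictly_convex_body K \<and> H_sep K \<ge> 29"
    using separated_H_sep[OF config9(2), where 'n = 'n and N = 29]
    by (simp add: config9(1) numeral_eq_enat)
next
  assume "CARD('n) = 10"
  then show "\<exists>K :: (real ^ 'n) set. smooth_body K \<and> strictly_convex_body K \<and> H_sep K \<ge> 39"
    using separated_H_sep[OF config10(2), where 'n = 'n and N = 39]
    by (simp add: config10(1) numeral_eq_enat)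
next
  assume "CARD('n) = 11"
  then show "\<exists>K :: (real ^ 'n) set. smooth_body K \<and> strictly_convex_body K \<and> H_sep K \<ge> 50"
    using separated_H_sep[OF config11(2), where 'n = 'n and N = 50]
    by (simp add: config11(1) numeral_eq_enat)
next
  assume "CARD('n) = 12"
  then show "\<exists>K :: (real ^ 'n) set. smooth_body K \<and> strictly_convex_body K \<and> H_sep K \<ge> 65"
    using separated_H_sep[OF config12(2), where 'n = 'n and N = 65]
    by (simp add: config12(1) numeral_eq_enat)
next
  assume "CARD('n) = 14"
  then show "\<exists>K :: (real ^ 'n) set. smooth_body K \<and> strictly_convex_body K \<and> H_sep K \<ge> 91"
    using separated_H_sep[OF config14(2), where 'n = 'n and N = 91]
    by (simp add: config14(1) numeral_eq_enat)
qed

end
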